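(* Let $G$ be the alternating group $A_n$ with $n\geq 6$. Assume that there is a binary action of $G$ on the finite set $\Omega$. Then each orbit of $G$ on $\Omega$ is either trivial (a single point) or regular.
   Context: All groups and sets are finite; groups act on the right. An orbit is regular if $G$ acts on it regularly, i.e. transitively with trivial point stabilizers. Binary: for $I=(I_1,\dots,I_n)$, $J=(J_1,\dots,J_n)\in\Omega^n$ and $r\le n$, say $I$ and $J$ are $r$-related if for every choice of indices $1\le k_1<\dots<k_r\le n$ there is $g\in G$ with $I_{k_i}^g=J_{k_i}$ for all $i$. The relational complexity $\mathrm{RC}(G,\Omega)$ is the smallest integer $k\ge 2$ such that, for all $n\ge k$ and all $I,J\in\Omega^n$, if $I$ and $J$ are $k$-related then they are $n$-related (i.e. $I^g=J$ for some $g\in G$). The action of $G$ on $\Omega$ (not necessarily faithful or transitive) is binary if $\mathrm{RC}(G,\Omega)=2$. *)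

theory Defs
  imports "HOL-Algebra.Group_Action" "HOL-Algebra.Sym_Groups"
begin

text \<open>
  Tuples are lists with entries numbered from \<open>0\<close>, and a choice of indices
  \<open>k\<^sub>1 < \<dots> < k\<^sub>r\<close> is given by the set \<open>K\<close> of these indices. Actions are those of
  \<^locale>\<open>group_action\<close>, with \<open>x\<^sup>g\<close> written \<open>\<phi> g x\<close>. They satisfy
  \<open>\<phi> (g \<otimes> h) x = \<phi> g (\<phi> h x)\<close>. For permutation groups, whose product is composition of
  functions (\<open>h\<close> first), this is exactly a right action of the same permutations multiplied
  from left to right.
\<close>

definition r_related ::
  "('g, 'm) monoid_scheme \<Rightarrow> ('g \<Rightarrow> 'a \<Rightarrow> 'a) \<Rightarrow> nat \<Rightarrow> 'a list \<Rightarrow> 'a list \<Rightarrow> bool"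
  where "r_related G \<phi> r I J \<longleftrightarrow>
    length I = length J \<and> r \<le> length I \<and>
    (\<forall>K. K \<subseteq> {..<length I} \<and> card K = r \<longrightarrow>
      (\<exists>g \<in> carrier G. \<forall>i \<in> K. \<phi> g (I ! i) = J ! i))"

definition relatedness_suffices ::
  "('g, 'm) monoid_scheme \<Rightarrow> 'a set \<Rightarrow> ('g \<Rightarrow> 'a \<Rightarrow> 'a) \<Rightarrow> nat \<Rightarrow> bool"
  where "relatedness_suffices G \<Omega> \<phi> k \<longleftrightarrow>
    (\<forall>n \<ge> k. \<forall>I J. length I = n \<and> length J = n \<and> set I \<subseteq> \<Omega> \<and> set J \<subseteq> \<Omega> \<longrightarrow>
      r_related G \<phi> k I J \<longrightarrow> r_related G \<phi> n I J)"

definition relational_complexity ::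
  "('g, 'm) monoid_scheme \<Rightarrow> 'a set \<Rightarrow> ('g \<Rightarrow> 'a \<Rightarrow> 'a) \<Rightarrow> nat"
  where "relational_complexity G \<Omega> \<phi> = (LEAST k. 2 \<le> k \<and> relatedness_suffices G \<Omega> \<phi> k)"

text \<open>The minimum exists whenever \<open>\<Omega>\<close> is finite.\<close>

lemma relational_complexity_exists:
  fixes \<Omega> :: "'a set"
  assumes "finite \<Omega>"
  shows "\<exists>k \<ge> 2. relatedness_suffices G \<Omega> \<phi> k"
proof (intro exI conjI)
  define k where "k = max 2 (card \<Omega>)"
  show "2 \<le> k" by (simp add: k_def)
  show "relatedness_suffices G \<Omega> \<phi> k"
    unfolding relatedness_suffices_def
  proof (intro allI impI, elim conjE)
    fix n and I J :: "'a list"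
    assume n: "k \<le> n" and lI: "length I = n" and lJ: "length J = n"
      and sub: "set I \<subseteq> \<Omega>" and rel: "r_related G \<phi> k I J"
    have small: "\<exists>g \<in> carrier G. \<forall>i \<in> K. \<phi> g (I ! i) = J ! i"
      if K: "K \<subseteq> {..<n}" "card K \<le> k" for K
    proof -
      obtain K' where "K \<subseteq> K'" "K' \<subseteq> {..<n}" "card K' = k"
        using exists_subset_between[OF K(2) _ K(1)] n by auto
      moreover have "\<exists>g \<in> carrier G. \<forall>i \<in> K'. \<phi> g (I ! i) = J ! i"
        using rel calculation(2,3) unfolding r_related_def lI by simp
      ultimately show ?thesis by (meson subsetD)
    qed
    define rep where "rep x = (SOME j. j < n \<and> I ! j = x)" for x
    have rep: "rep x < n \<and> I ! rep x = x" if "x \<in> set I" for x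
      unfolding rep_def by (rule someI_ex) (use that lI in \<open>simp add: in_set_conv_nth\<close>)
    have "card (rep ` set I) \<le> card (set I)" by (rule card_image_le) simp
    also have "\<dots> \<le> card \<Omega>" using sub assms by (simp add: card_mono)
    finally have "card (rep ` set I) \<le> k" by (simp add: k_def)
    then obtain g where g: "g \<in> carrier G" "\<forall>j \<in> rep ` set I. \<phi> g (I ! j) = J ! j"
      using small[of "rep ` set I"] rep by (metis (no_types, lifting) image_subsetI lessThan_iff)
    have "\<phi> g (I ! i) = J ! i" if i: "i < n" for i
    proof -
      have mem: "I ! i \<in> set I" using i lI by simp
      let ?j = "rep (I ! i)"
      have "card {i, ?j} \<le> k" using card_insert_le_m1[of 2 "{?j}" i] by (simp add: k_def)
      then obtain h where "\<phi> h (I ! i) = J ! i" "\<phi> h (I ! ?j) = J ! ?j"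
        using small[of "{i, ?j}"] i rep[OF mem] by fastforce
      moreover have "\<phi> g (I ! ?j) = J ! ?j" using g(2) mem by simp
      ultimately show ?thesis using rep[OF mem] by metis
    qed
    then have "\<forall>i \<in> K. \<phi> g (I ! i) = J ! i" if "K \<subseteq> {..<n}" for K
      using that by (meson lessThan_iff subsetD)
    then show "r_related G \<phi> n I J"
      using g(1) unfolding r_related_def lI lJ by (meson order_refl)
  qed
qed

definition binary_action ::
  "('g, 'm) monoid_scheme \<Rightarrow> 'a set \<Rightarrow> ('g \<Rightarrow> 'a \<Rightarrow> 'a) \<Rightarrow> bool"
  where "binary_action G \<Omega> \<phi> \<longleftrightarrow> group_action G \<Omega> \<phi> \<and> relational_complexity G \<Omega> \<phi> = 2"

definition regular_action ::
  "('g, 'm) monoid_scheme \<Rightarrow> 'a set \<Rightarrow> ('g \<Rightarrow> 'a \<Rightarrow> 'a) \<Rightarrow> bool"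
  where "regular_action G \<Omega> \<phi> \<longleftrightarrow>
    transitive_action G \<Omega> \<phi> \<and> (\<forall>x \<in> \<Omega>. stabilizer G \<phi> x = {\<one>\<^bsub>G\<^esub>})"

text \<open>
  The elements of \<^term>\<open>BijGroup \<Delta>\<close> are extensional functions, so the induced action on an
  orbit has to be restricted to it explicitly.
\<close>

definition regular_orbit ::
  "('g, 'm) monoid_scheme \<Rightarrow> ('g \<Rightarrow> 'a \<Rightarrow> 'a) \<Rightarrow> 'a set \<Rightarrow> bool"
  where "regular_orbit G \<phi> \<Delta> \<longleftrightarrow> regular_action G \<Delta> (\<lambda>g. restrict (\<phi> g) \<Delta>)"

end

theory Submission
  imports Defs "HOL-Algebra.Multiplicative_Group"
begin

text \<open>
  The claim is that every point stabilizer is trivial or the whole group. Binarity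
  enters in one way only: a map between points that is induced by group elements on each pair of
  points is induced by a single group element. If such a map exchanges two points, the element
  inducing it has even order, so a power of it is an involution that still fixes every
  point fixed by the map. Two maps of this kind carry the proof.

  The first shows that a nontrivial stabilizer contains an involution
  (\<open>involution_of_nontrivial_stabilizer\<close>). Suppose it contains an element \<open>g \<noteq> 1\<close> of odd order.
  If some commutator \<open>[g, k] = g k g\<^sup>-\<^sup>1 k\<^sup>-\<^sup>1\<close> is an involution, then the point fixed by \<open>g\<close>, its image
  under \<open>k\<close> and the image of the latter under \<open>g\<close> form a triple whose last two
  entries may be exchanged (\<open>involution_from_commutator\<close>). In degree at least six a suitable even \<open>k\<close> can be
  written down for every such \<open>g\<close> (\<open>involutive_commutator_exists\<close>).

  The second concerns involutions with the largest possible number of fixed points. If \<open>g\<close>, \<open>h\<close>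
  and \<open>g h\<close> are three such involutions, then they have the same fixed points (\<open>Fix_eq_if_commuting\<close>).
  Involutions of maximal fixity are closed under conjugation, so the set of
  fixed points spreads through the conjugacy class of \<open>g\<close> along Klein four-groups that lie in
  it. Such four-groups lead from any even involution to a
  double transposition (\<open>max_fixity_double_transposition\<close>), from there to all double transpositions
  (\<open>dominant_everywhere\<close>), and hence to all 3-cycles, which generate the group. So the fixed points of an
  involution of maximal fixity are fixed by the whole group, and then no involution at all fixes any other
  point (\<open>stabilizer_trivial_or_full\<close>).
\<close>


section \<open>Involutions and elements of odd order\<close>

definition (in group) involution :: "'a \<Rightarrow> bool" where
  "involution t \<longleftrightarrow> t \<in> carrier G \<and> t \<noteq> \<one> \<and> t \<otimes> t = \<one>"

lemma (in group) odd_order_or_involution: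
  assumes "finite (carrier G)" and x: "x \<in> carrier G"
  shows "(\<exists>m::nat. x [^] (2 * m + 1) = \<one>) \<or> (\<exists>m::nat. involution (x [^] m))"
proof (cases "even (ord x)")
  case False
  then show ?thesis
    by (metis oddE pow_ord_eq_1 x)
next
  case True
  then obtain m where m: "ord x = 2 * m" ..
  have "ord x \<ge> 1" using assms by (rule ord_ge_1)
  then have "x [^] m \<noteq> \<one>"
    using m pow_eq_id[OF x, of m] by (auto dest: dvd_imp_le)
  moreover have "x [^] m \<otimes> x [^] m = \<one>"
    by (metis m mult_2 nat_pow_mult pow_ord_eq_1 x)
  ultimately show ?thesis
    using x unfolding involution_def by auto
qed

lemma (in group_action) pow_fixes:
  assumes "x \<in> carrier G" "a \<in> E" "\<phi> x a = a"
  shows "\<phi> (x [^] (m::nat)) a = a"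
proof -
  interpret group G using group_hom group_hom.axioms(1) by blast
  have "\<phi> \<one> a = a" using assms(2) by (metis id_eq_one restrict_apply')
  then show ?thesis
  proof (induction m)
    case (Suc m)
    then show ?case
      using assms composition_rule[OF assms(2), of "x [^] m" x] by simp
  qed simp
qed

text \<open>
  An element of odd order \<open>2 m + 1\<close> moves no point along a cycle of length two: if its square
  fixes a point then so does its power \<open>2 m\<close>, which is its inverse.
\<close>

lemma (in group_action) odd_order_fixes:
  assumes x: "x \<in> carrier G" and a: "a \<in> E" and "\<phi> x (\<phi> x a) = a"
    and odd: "x [^] (2 * m + 1 :: nat) = \<one>"
  shows "\<phi> x a = a"
proof -
  interpret group G using group_hom group_hom.axioms(1) by blast
  have "\<phi> (x \<otimes> x) a = a" using assms by (simp add: composition_rule)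
  then have "\<phi> ((x \<otimes> x) [^] m) a = a" using x a by (intro pow_fixes) auto
  moreover have "x \<otimes> (x \<otimes> x) [^] m = \<one>"
  proof -
    have "x \<otimes> x = x [^] (2::nat)" using x by (simp add: numeral_2_eq_2)
    then have "(x \<otimes> x) [^] m = x [^] (2 * m)" using x by (simp add: nat_pow_pow)
    then show ?thesis using odd x by (metis nat_pow_Suc2 Suc_eq_plus1)
  qed
  moreover have "\<phi> \<one> a = a" using a by (metis id_eq_one restrict_apply')
  ultimately show ?thesis
    using composition_rule[of a x "(x \<otimes> x) [^] m"] x a by auto
qed

section \<open>Gluing maps in binary actions\<close>

text \<open>
  The form in which binarity is used: a map on a set of points that agrees on any two of them with
  some group element agrees on all of them with one group element. Working with maps in place
  of pairs of tuples removes all bookkeeping with indices.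
\<close>

locale gluing_action = group_action +
  assumes finite_group: "finite (carrier G)"
    and finite_points: "finite E"
    and glue: "\<And>X \<tau>. \<lbrakk>X \<subseteq> E; \<And>x y. \<lbrakk>x \<in> X; y \<in> X\<rbrakk> \<Longrightarrow> \<exists>g \<in> carrier G. \<phi> g x = \<tau> x \<and> \<phi> g y = \<tau> y\<rbrakk>
      \<Longrightarrow> \<exists>g \<in> carrier G. \<forall>x \<in> X. \<phi> g x = \<tau> x"

sublocale gluing_action \<subseteq> group G
  using group_hom group_hom.axioms(1) by blast

lemma binary_action_gluing:
  fixes G (structure) and \<Omega> :: "'b set"
  assumes bin: "binary_action G \<Omega> \<phi>" and fin: "finite \<Omega>" "finite (carrier G)"
  shows "gluing_action G \<Omega> \<phi>"
proof -
  interpret group_action G \<Omega> \<phi> using bin by (simp add: binary_action_def)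
  interpret group G using group_hom group_hom.axioms(1) by blast
  have suff: "relatedness_suffices G \<Omega> \<phi> 2"
    using LeastI_ex[OF relational_complexity_exists[OF fin(1), unfolded Bex_def], of G \<phi>] bin
    unfolding binary_action_def relational_complexity_def by auto
  show ?thesis
  proof (unfold_locales; (intro fin)?)
    fix X \<tau>
    assume X: "X \<subseteq> \<Omega>"
      and pair: "\<And>x y. \<lbrakk>x \<in> X; y \<in> X\<rbrakk> \<Longrightarrow> \<exists>g\<in>carrier G. \<phi> g x = \<tau> x \<and> \<phi> g y = \<tau> y"
    obtain xs where xs: "set xs = X" using finite_list finite_subset[OF X fin(1)] by blast
    show "\<exists>g\<in>carrier G. \<forall>x\<in>X. \<phi> g x = \<tau> x"
    proof (cases "X = {}")
      case True
      then show ?thesis by blast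
    next
      case False
      \<comment> \<open>Doubling the list makes it long enough when \<open>X\<close> is a single point.\<close>
      define I where "I = xs @ xs"
      have len: "length I \<ge> 2" using False xs unfolding I_def by (cases xs) auto
      have I: "set I = X" using xs by (simp add: I_def)
      have J: "set (map \<tau> I) \<subseteq> \<Omega>"
      proof -
        have "\<tau> x \<in> \<Omega>" if x: "x \<in> X" for x
        proof -
          obtain g where "g \<in> carrier G" "\<phi> g x = \<tau> x" using pair[OF x x] by blast
          then show ?thesis using element_image x X by blast
        qed
        then show ?thesis using I by auto
      qed
      have "r_related G \<phi> 2 I (map \<tau> I)"
        unfolding r_related_def
      proof (intro conjI allI impI)
        fix K assume K: "K \<subseteq> {..<length I} \<and> card K = 2"
        then obtain i j where ij: "K = {i, j}" by (auto simp: card_2_iff)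
        with K have "I ! i \<in> X" "I ! j \<in> X" "i < length I" "j < length I" using I by auto
        then show "\<exists>g\<in>carrier G. \<forall>i\<in>K. \<phi> g (I ! i) = map \<tau> I ! i"
          using pair[of "I ! i" "I ! j"] ij by auto
      qed (use len in auto)
      moreover have "length (map \<tau> I) = length I" "set I \<subseteq> \<Omega>" using I X by simp_all
      ultimately have "r_related G \<phi> (length I) I (map \<tau> I)"
        using suff len J unfolding relatedness_suffices_def by blast
      then have "\<exists>g\<in>carrier G. \<forall>i\<in>{..<length I}. \<phi> g (I ! i) = map \<tau> I ! i"
        unfolding r_related_def by (metis card_lessThan order_refl)
      then obtain g where g: "g \<in> carrier G" "\<forall>i<length I. \<phi> g (I ! i) = \<tau> (I ! i)"
        by auto
      then show ?thesis using I by (metis in_set_conv_nth)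
    qed
  qed
qed

context gluing_action
begin

lemma act_one: "a \<in> E \<Longrightarrow> \<phi> \<one> a = a"
  by (metis id_eq_one restrict_apply')

lemma act_closed: "g \<in> carrier G \<Longrightarrow> a \<in> E \<Longrightarrow> \<phi> g a \<in> E"
  using element_image by blast

lemma act_mult: "g \<in> carrier G \<Longrightarrow> h \<in> carrier G \<Longrightarrow> a \<in> E \<Longrightarrow> \<phi> (g \<otimes> h) a = \<phi> g (\<phi> h a)"
  by (rule composition_rule)

lemma act_inv: "g \<in> carrier G \<Longrightarrow> a \<in> E \<Longrightarrow> \<phi> (inv g) (\<phi> g a) = a"
  by (metis act_mult act_one inv_closed l_inv)

lemma involution_closed: "involution t \<Longrightarrow> t \<in> carrier G"
  by (simp add: involution_def)

lemma involution_act: "involution t \<Longrightarrow> a \<in> E \<Longrightarrow> \<phi> t (\<phi> t a) = a"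
  by (metis act_mult act_one involution_def)

lemma involution_conj:
  assumes "involution g" "k \<in> carrier G" "h \<in> carrier G" "k \<otimes> g = h \<otimes> k"
  shows "involution h"
proof -
  have g: "g \<in> carrier G" "g \<noteq> \<one>" "g \<otimes> g = \<one>" using assms by (auto simp: involution_def)
  have h: "h = k \<otimes> g \<otimes> inv k" using assms g by (metis inv_solve_right m_closed)
  have "h \<noteq> \<one>" using assms g by (metis l_cancel_one' l_one r_one r_cancel_one)
  moreover have "h \<otimes> h \<otimes> k = k"
    using assms g by (metis m_assoc r_one)
  then have "h \<otimes> h = \<one>" using assms by (metis m_closed r_cancel_one')
  ultimately show ?thesis using assms by (simp add: involution_def)
qed

lemma swap_gives_involution:
  assumes x: "x \<in> carrier G" and b: "b \<in> E" "\<phi> x b \<noteq> b" "\<phi> x (\<phi> x b) = b"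
  obtains m :: nat where "involution (x [^] m)"
  using odd_order_or_involution[OF finite_group x] odd_order_fixes[OF x b(1) b(3)] b(2) by blast

section \<open>Involutions in point stabilizers\<close>

text \<open>
  Here \<open>s\<close> is the commutator of \<open>g\<close> and \<open>k\<close>. Put \<open>\<beta> = \<phi> k a\<close>. The map fixing \<open>a\<close> and exchanging
  \<open>\<beta>\<close> with \<open>\<phi> g \<beta>\<close> is given on \<open>{a, \<beta>}\<close> by \<open>g\<close>, on \<open>{a, \<phi> g \<beta>}\<close> by the inverse of \<open>g\<close>, and
  on \<open>{\<beta>, \<phi> g \<beta>}\<close> by \<open>s\<close>, since \<open>g\<close> fixes \<open>a\<close>. So one element \<open>x\<close> fixing \<open>a\<close> induces all of it,
  and \<open>x\<close> has even order because it exchanges two points. If \<open>\<beta> = \<phi> g \<beta>\<close>, then \<open>s\<close> itself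
  fixes \<open>\<beta>\<close>, and its conjugate under \<open>k\<close> fixes \<open>a\<close>.
\<close>

lemma involution_from_commutator:
  assumes a: "a \<in> E" and g: "g \<in> carrier G" "\<phi> g a = a" and k: "k \<in> carrier G"
    and s: "involution s" "s \<otimes> k \<otimes> g = g \<otimes> k"
  obtains t where "involution t" "\<phi> t a = a"
proof -
  let ?b = "\<phi> k a"
  have sc: "s \<in> carrier G" using s by (simp add: involution_def)
  have b: "?b \<in> E" using a k by (rule act_closed[rotated])
  have sb: "\<phi> s ?b = \<phi> g ?b"
  proof -
    have "\<phi> (s \<otimes> k \<otimes> g) a = \<phi> s ?b" using a g k sc by (simp add: act_mult act_closed)
    then show ?thesis using a g k s by (simp add: act_mult)
  qed
  show thesis
  proof (cases "\<phi> g ?b = ?b")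
    case True
    define t where "t = inv k \<otimes> s \<otimes> k"
    have t: "t \<in> carrier G" using k sc by (simp add: t_def)
    have "involution t"
      by (rule involution_conj[OF s(1), of "inv k"]) (use k sc t in \<open>auto simp: t_def m_assoc\<close>)
    moreover have "\<phi> t a = a"
      using a k sc b sb True by (simp add: t_def act_mult act_closed act_inv)
    ultimately show thesis by (rule that)
  next
    case False
    let ?c = "\<phi> g ?b"
    have c: "?c \<in> E" using b g by (metis act_closed)
    have ab: "a \<noteq> ?b" using False g by auto
    have ac: "a \<noteq> ?c" using ab g a b by (metis act_inv)
    define \<tau> where "\<tau> = id(?b := ?c, ?c := ?b)"
    have \<tau>: "\<tau> a = a" "\<tau> ?b = ?c" "\<tau> ?c = ?b" using ab ac False by (auto simp: \<tau>_def)
    have ig: "inv g \<in> carrier G" "\<phi> (inv g) a = a" "\<phi> (inv g) ?c = ?b"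
      using g a b act_inv by (auto, metis act_inv)
    have sc': "\<phi> s ?c = ?b" using sb s b by (metis involution_act)
    have e1: "\<exists>x \<in> carrier G. \<phi> x a = \<tau> a \<and> \<phi> x ?b = \<tau> ?b" using g \<tau> by auto
    have e2: "\<exists>x \<in> carrier G. \<phi> x a = \<tau> a \<and> \<phi> x ?c = \<tau> ?c" using ig \<tau> by auto
    have e3: "\<exists>x \<in> carrier G. \<phi> x ?b = \<tau> ?b \<and> \<phi> x ?c = \<tau> ?c" using sc sc' sb \<tau> by auto
    have "\<exists>x \<in> carrier G. \<forall>z \<in> {a, ?b, ?c}. \<phi> x z = \<tau> z"
    proof (rule glue)
      fix u v assume uv: "u \<in> {a, ?b, ?c}" "v \<in> {a, ?b, ?c}"
      show "\<exists>x \<in> carrier G. \<phi> x u = \<tau> u \<and> \<phi> x v = \<tau> v"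
        using uv e1 e2 e3 by (elim insertE emptyE) (hypsubst; blast)+
    qed (use a b c in simp)
    then obtain x where x: "x \<in> carrier G" "\<phi> x a = a" "\<phi> x ?b = ?c" "\<phi> x ?c = ?b"
      using \<tau> by auto
    obtain m :: nat where "involution (x [^] m)"
      using swap_gives_involution[OF x(1) b] x False by auto
    then show thesis using that pow_fixes[OF x(1) a x(2)] by blast
  qed
qed

section \<open>Involutions with the most fixed points\<close>

abbreviation Fix :: "'a \<Rightarrow> 'c set" where
  "Fix \<equiv> invariants E \<phi>"

lemma Fix_iff: "a \<in> Fix g \<longleftrightarrow> a \<in> E \<and> \<phi> g a = a"
  by (simp add: invariants_def)

lemma finite_Fix: "finite (Fix g)"
  using finite_points by (simp add: invariants_def)

definition max_fixity :: "'a \<Rightarrow> bool" where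
  "max_fixity t \<longleftrightarrow> involution t \<and> (\<forall>u. involution u \<longrightarrow> card (Fix u) \<le> card (Fix t))"

lemma ex_max_fixity:
  assumes "involution t"
  obtains u where "max_fixity u"
proof -
  let ?I = "{u. involution u}"
  have "finite ?I" using finite_group by (rule finite_subset[rotated]) (auto simp: involution_def)
  moreover have "?I \<noteq> {}" using assms by blast
  ultimately have "finite ((\<lambda>u. card (Fix u)) ` ?I)" "(\<lambda>u. card (Fix u)) ` ?I \<noteq> {}" by auto
  then obtain u where "involution u" "\<forall>v. involution v \<longrightarrow> card (Fix v) \<le> card (Fix u)"
    using Max_in Max_ge by (smt (verit, best) image_iff mem_Collect_eq)
  then show thesis using that by (auto simp: max_fixity_def)
qed

lemma max_fixity_supset:
  assumes "max_fixity g" "involution t" "Fix g \<subseteq> Fix t"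
  shows "max_fixity t" "Fix t = Fix g"
proof -
  have le: "card (Fix t) \<le> card (Fix g)" using assms by (auto simp: max_fixity_def)
  show "Fix t = Fix g" using card_seteq[OF finite_Fix assms(3) le] by simp
  then show "max_fixity t" using assms by (auto simp: max_fixity_def)
qed

lemma max_fixity_conj:
  assumes g: "max_fixity g" and k: "k \<in> carrier G" "h \<in> carrier G" "k \<otimes> g = h \<otimes> k"
  shows "max_fixity h"
proof -
  have gi: "involution g" using g by (simp add: max_fixity_def)
  then have gc: "g \<in> carrier G" by (simp add: involution_def)
  have hi: "involution h" using involution_conj[OF gi k] .
  have "\<phi> k ` Fix g \<subseteq> Fix h"
  proof
    fix y assume "y \<in> \<phi> k ` Fix g"
    then obtain x where x: "x \<in> E" "\<phi> g x = x" "y = \<phi> k x" by (auto simp: Fix_iff)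
    have "\<phi> h (\<phi> k x) = \<phi> k (\<phi> g x)" using x gc k by (metis act_mult)
    then show "y \<in> Fix h" using x k by (auto simp: Fix_iff act_closed)
  qed
  moreover have "inj_on (\<phi> k) (Fix g)"
    by (rule inj_on_subset[OF inj_prop[OF k(1)]]) (auto simp: Fix_iff)
  ultimately have "card (Fix g) \<le> card (Fix h)"
    using card_inj_on_le finite_Fix by blast
  then show ?thesis using g hi by (auto simp: max_fixity_def intro: le_trans)
qed

text \<open>
  Let \<open>\<tau>\<close> act as \<open>g\<close> on \<open>Fix h\<close> and trivially on \<open>Fix g\<close> and \<open>Fix (g \<otimes> h)\<close>. On any two of these three
  sets it is induced by one of \<open>g\<close>, \<open>g \<otimes> h\<close> and the identity, so binarity provides an element \<open>x\<close>
  inducing it on all three. If \<open>\<tau>\<close> is not trivial then \<open>x\<close> has even order, and some power of it is an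
  involution fixing \<open>Fix g\<close> and \<open>Fix (g \<otimes> h)\<close> pointwise. By maximality this forces
  \<open>Fix g = Fix (g \<otimes> h)\<close>, and a point fixed by \<open>g\<close> and by \<open>g \<otimes> h\<close> is fixed by \<open>h\<close>. If \<open>\<tau>\<close> is trivial
  then \<open>g\<close> fixes \<open>Fix h\<close> pointwise, and the two sets have the same size.
\<close>

lemma Fix_eq_if_commuting:
  assumes g: "max_fixity g" and h: "max_fixity h" and gh: "max_fixity (g \<otimes> h)"
  shows "Fix h = Fix g"
proof -
  have i: "involution g" "involution h" "involution (g \<otimes> h)"
    using assms by (auto simp: max_fixity_def)
  then have c: "g \<in> carrier G" "h \<in> carrier G" by (auto simp: involution_def)
  have comm: "\<phi> g (\<phi> h a) = \<phi> h (\<phi> g a)" if "a \<in> E" for a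
    using that i c by (metis act_closed act_mult involution_act)
  have le: "card (Fix h) = card (Fix g)" "card (Fix (g \<otimes> h)) = card (Fix g)"
    using assms by (auto simp: max_fixity_def intro: le_antisym)
  have third: "Fix g \<inter> Fix (g \<otimes> h) \<subseteq> Fix h"
    using i c comm by (fastforce simp: Fix_iff act_mult)
  define \<tau> where "\<tau> = (\<lambda>u. if u \<in> Fix h then \<phi> g u else u)"
  define U where "U = Fix h \<union> Fix g \<union> Fix (g \<otimes> h)"
  have "\<exists>x\<in>carrier G. \<forall>u\<in>U. \<phi> x u = \<tau> u"
  proof (rule glue)
    show "U \<subseteq> E" by (auto simp: U_def Fix_iff)
    have main: "\<exists>x\<in>carrier G. \<phi> x u = \<tau> u \<and> \<phi> x v = \<tau> v" if uv: "u \<in> Fix h" "v \<in> U" for u v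
    proof (cases "v \<in> Fix h \<union> Fix g")
      case True
      then show ?thesis using uv c by (intro bexI[of _ g]) (auto simp: \<tau>_def Fix_iff)
    next
      case False
      then show ?thesis using uv c
        by (intro bexI[of _ "g \<otimes> h"]) (auto simp: \<tau>_def U_def Fix_iff act_mult)
    qed
    fix u v assume uv: "u \<in> U" "v \<in> U"
    consider "u \<in> Fix h" | "v \<in> Fix h" | "u \<notin> Fix h" "v \<notin> Fix h" by blast
    then show "\<exists>x\<in>carrier G. \<phi> x u = \<tau> u \<and> \<phi> x v = \<tau> v"
    proof cases
      case 3
      then show ?thesis using uv
        by (intro bexI[of _ \<one>]) (auto simp: \<tau>_def U_def Fix_iff act_one)
    qed (use main uv in blast)+
  qed
  then obtain x where x: "x \<in> carrier G" "\<And>u. u \<in> U \<Longrightarrow> \<phi> x u = \<tau> u" by blast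
  show ?thesis
  proof (cases "Fix h \<subseteq> Fix g")
    case True
    then show ?thesis using card_subset_eq[OF finite_Fix] le by blast
  next
    case False
    then obtain b where b: "b \<in> Fix h" "\<phi> g b \<noteq> b" "b \<in> E" unfolding Fix_iff subset_iff by blast
    have "\<phi> g b \<in> Fix h" using b c comm by (auto simp: Fix_iff act_closed) (metis comm)
    then have "\<phi> x b = \<phi> g b" "\<phi> x (\<phi> g b) = b"
      using b x i by (auto simp: \<tau>_def U_def involution_act)
    then obtain m :: nat where z: "involution (x [^] m)"
      using swap_gives_involution[OF x(1) b(3)] b by metis
    have "\<phi> x u = u" if "u \<in> Fix g \<union> Fix (g \<otimes> h)" for u
      using x(2)[of u] that c by (auto simp: \<tau>_def U_def Fix_iff act_mult)
    then have sub: "Fix g \<subseteq> Fix (x [^] m)" "Fix (g \<otimes> h) \<subseteq> Fix (x [^] m)"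
      using pow_fixes[OF x(1)] by (auto simp: Fix_iff)
    have "Fix (g \<otimes> h) = Fix g"
      using max_fixity_supset(2)[OF g z sub(1)] max_fixity_supset(2)[OF gh z sub(2)] by simp
    then have "Fix g \<subseteq> Fix h" using third by blast
    then show ?thesis using card_subset_eq[OF finite_Fix] le by metis
  qed
qed

end

section \<open>Commutators of order two in alternating groups\<close>

lemma double_transposition_in_alt:
  assumes "{a, b, c, d} \<subseteq> {1..n}" "a \<noteq> b" "c \<noteq> d"
  shows "transpose a b \<circ> transpose c d \<in> carrier (alt_group n)"
proof -
  have "transpose a b permutes {1..n}" "transpose c d permutes {1..n}"
    using assms by (auto intro: permutes_swap_id)
  then show ?thesis
    using assms
    by (auto simp: alt_group_carrier evenperm_comp permutation_swap_id evenperm_swap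
        intro: permutes_compose)
qed

lemma double_transposition_involution:
  assumes "{a, b, c, d} \<subseteq> {1..n}" "distinct [a, b, c, d]"
  shows "group.involution (alt_group n) (transpose a b \<circ> transpose c d)"
proof -
  interpret group "alt_group n" by (rule alt_group_is_group)
  have "(transpose a b \<circ> transpose c d) a \<noteq> id a" using assms by simp
  then have "transpose a b \<circ> transpose c d \<noteq> id" by metis
  moreover have "(transpose a b \<circ> transpose c d) \<circ> (transpose a b \<circ> transpose c d) = id"
    using assms by (auto simp: fun_eq_iff transpose_def)
  ultimately show ?thesis
    using assms double_transposition_in_alt[of a b c d n]
    by (auto simp: involution_def alt_group_mult alt_group_one)
qed

lemma three_cycle_commutator:
  assumes "distinct [a, b, c, y]"
  shows "(transpose a b \<circ> transpose c y) \<circ> (transpose a b \<circ> transpose b y)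
    = transpose b c \<circ> transpose c y"
proof
  fix z
  show "((transpose a b \<circ> transpose c y) \<circ> (transpose a b \<circ> transpose b y)) z
    = (transpose b c \<circ> transpose c y) z"
    using assms by (cases "z \<in> {a, b, c, y}") auto
qed

lemma double_transposition_commutator:
  assumes "distinct [a, b, c, x, y, z]"
  shows "(transpose a x \<circ> transpose c z) \<circ> (transpose a x \<circ> transpose b y)
    = transpose b y \<circ> transpose c z"
proof
  fix w
  show "((transpose a x \<circ> transpose c z) \<circ> (transpose a x \<circ> transpose b y)) w
    = (transpose b y \<circ> transpose c z) w"
    using assms by (cases "w \<in> {a, b, c, x, y, z}") auto
qed

text \<open>
  Conjugation by \<open>g\<close> shifts the points of a permutation along the cycles of \<open>g\<close>, none of which
  has length two. If \<open>g\<close> fixes a point \<open>y\<close>, take for \<open>k\<close> a 3-cycle on \<open>y\<close> and two consecutive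
  points of a cycle of \<open>g\<close>. If not, take \<open>k = (x y)(g x g y)\<close>: it commutes with its shift
  \<open>(g x g y)(g\<^sup>2 x g\<^sup>2 y)\<close> and the transposition \<open>(g x g y)\<close> cancels in the commutator.
  It suffices here that \<open>y\<close> avoids the five points \<open>g\<^sup>i x\<close> with \<open>-2 \<le> i \<le> 2\<close>, which is why six points are
  enough, and \<open>x\<close> and \<open>y\<close> may or may not lie on the same cycle.
\<close>

lemma involutive_commutator_exists:
  assumes n: "n \<ge> 6" and g: "g \<in> carrier (alt_group n)" "g \<noteq> id"
    and no2: "\<And>z. g (g z) = z \<Longrightarrow> g z = z"
  obtains k s where "k \<in> carrier (alt_group n)" "group.involution (alt_group n) s"
    "s \<circ> k \<circ> g = g \<circ> k"
proof -
  have perm: "g permutes {1..n}" using g by (simp add: alt_group_carrier)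
  then have bij: "bij g" by (rule permutes_bij)
  have inj: "g u = g v \<longleftrightarrow> u = v" for u v using bij by (simp add: bij_is_inj inj_eq)
  have ran: "g u \<in> {1..n} \<longleftrightarrow> u \<in> {1..n}" for u by (rule permutes_in_image[OF perm])
  have shift: "g \<circ> transpose u v = transpose (g u) (g v) \<circ> g" for u v
    by (rule ext) (simp add: transpose_def inj)
  obtain x where x: "g x \<noteq> x" using g by (auto simp: fun_eq_iff)
  then have xn: "x \<in> {1..n}" using perm by (metis permutes_not_in)
  have x3: "distinct [x, g x, g (g x)]" using x no2 inj by auto
  have xr: "{x, g x, g (g x)} \<subseteq> {1..n}" using xn ran by simp
  show thesis
  proof (cases "\<exists>y \<in> {1..n}. g y = y")
    case True
    then obtain y where y: "y \<in> {1..n}" "g y = y" by blast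
    have xy: "y \<notin> {x, g x, g (g x)}" using x y inj by auto
    show thesis
    proof (rule that)
      show "transpose x (g x) \<circ> transpose (g x) y \<in> carrier (alt_group n)"
        using x3 xr xy y by (intro double_transposition_in_alt) auto
      show "group.involution (alt_group n) (transpose x (g x) \<circ> transpose (g (g x)) y)"
        using x3 xr xy y by (intro double_transposition_involution) auto
      have "(transpose x (g x) \<circ> transpose (g (g x)) y) \<circ> (transpose x (g x) \<circ> transpose (g x) y)
          = transpose (g x) (g (g x)) \<circ> transpose (g (g x)) y"
        using x3 xy by (intro three_cycle_commutator) auto
      moreover have "g \<circ> (transpose x (g x) \<circ> transpose (g x) y)
          = transpose (g x) (g (g x)) \<circ> transpose (g (g x)) y \<circ> g"
        using shift y by (metis comp_assoc)
      ultimately show "(transpose x (g x) \<circ> transpose (g (g x)) y) \<circ> (transpose x (g x) \<circ> transpose (g x) y) \<circ> g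
          = g \<circ> (transpose x (g x) \<circ> transpose (g x) y)" by simp
    qed
  next
    case False
    define S where "S = {x, g x, g (g x), inv' g x, inv' g (inv' g x)}"
    have "card S \<le> 5" unfolding S_def by (intro card_insert_le_m1) auto
    then have "\<not> {1..n} \<subseteq> S" using n card_mono[of S "{1..n}"] by (auto simp: S_def)
    then obtain y where y: "y \<in> {1..n}" "y \<notin> S" by blast
    have gy: "g y \<noteq> y" using False y by blast
    have y3: "distinct [y, g y, g (g y)]" using gy no2 inj by auto
    have yr: "{y, g y, g (g y)} \<subseteq> {1..n}" using y ran by simp
    have "y \<noteq> x" "y \<noteq> g x" "y \<noteq> g (g x)" "g y \<noteq> x" "g (g y) \<noteq> x"
      using y bij by (auto simp: S_def bij_is_inj inv_f_f)
    then have xy: "distinct [x, g x, g (g x), y, g y, g (g y)]"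
      using x3 y3 inj by auto
    show thesis
    proof (rule that)
      show "transpose x y \<circ> transpose (g x) (g y) \<in> carrier (alt_group n)"
        using xr yr xy by (intro double_transposition_in_alt) auto
      show "group.involution (alt_group n) (transpose x y \<circ> transpose (g (g x)) (g (g y)))"
        using xr yr xy by (intro double_transposition_involution) auto
      have "(transpose x y \<circ> transpose (g (g x)) (g (g y))) \<circ> (transpose x y \<circ> transpose (g x) (g y))
          = transpose (g x) (g y) \<circ> transpose (g (g x)) (g (g y))"
        using xy by (rule double_transposition_commutator)
      moreover have "g \<circ> (transpose x y \<circ> transpose (g x) (g y))
          = transpose (g x) (g y) \<circ> transpose (g (g x)) (g (g y)) \<circ> g"
        using shift by (metis comp_assoc)
      ultimately show "(transpose x y \<circ> transpose (g (g x)) (g (g y))) \<circ> (transpose x y \<circ> transpose (g x) (g y)) \<circ> g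
          = g \<circ> (transpose x y \<circ> transpose (g x) (g y))" by simp
    qed
  qed
qed

section \<open>Even involutions inside Klein four-groups of conjugates\<close>

text \<open>
  For an even involution \<open>g\<close>, this puts \<open>g\<close> into a Klein four-group \<open>{id, g, h, g \<circ> h}\<close> whose nontrivial
  elements are permuted cyclically by the even permutation \<open>c\<close>: conjugation by \<open>c\<close> sends \<open>g\<close> to \<open>h\<close> and
  \<open>h\<close> to \<open>g \<circ> h\<close>. For \<open>g = id\<close> all three permutations may be trivial, which is where the construction starts. The last clause confines \<open>h\<close> and \<open>c\<close> to the support of \<open>g\<close>, so that twists on
  disjoint supports can be multiplied.
\<close>

definition klein_twist :: "'a set \<Rightarrow> ('a \<Rightarrow> 'a) \<Rightarrow> ('a \<Rightarrow> 'a) \<Rightarrow> ('a \<Rightarrow> 'a) \<Rightarrow> bool" where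
  "klein_twist S g h c \<longleftrightarrow> c permutes S \<and> evenperm c \<and> h permutes S \<and>
     h \<circ> h = id \<and> c \<circ> g = h \<circ> c \<and> c \<circ> h = g \<circ> h \<circ> c \<and>
     (\<forall>x. g x = x \<longrightarrow> h x = x \<and> c x = x)"

text \<open>
  On the new block \<open>{a, b, c, d}\<close> the four-group is the normal Klein four-group of the alternating group of
  degree four, and the twist is the 3-cycle sending \<open>b\<close> to \<open>c\<close>, \<open>c\<close> to \<open>d\<close> and \<open>d\<close> to \<open>b\<close>. On and off the block
  the two factors do not interfere, so each identity can be checked point by point.
\<close>

lemma klein_twist_extend:
  assumes fin: "finite S" and tw: "klein_twist S g h e" and g: "g permutes S"
    and abcd: "distinct [a, b, c, d]" "{a, b, c, d} \<subseteq> S"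
    and fixed: "g a = a" "g b = b" "g c = c" "g d = d"
  shows "klein_twist S (g \<circ> (transpose a b \<circ> transpose c d)) (h \<circ> (transpose a c \<circ> transpose b d))
    (e \<circ> (transpose b c \<circ> transpose c d))"
proof -
  have p: "e permutes S" "h permutes S" and ev: "evenperm e"
    and hh: "\<And>x. h (h x) = x" and eg: "\<And>x. e (g x) = h (e x)"
    and eh: "\<And>x. e (h x) = g (h (e x))"
    and fx: "\<And>x. g x = x \<Longrightarrow> h x = x \<and> e x = x"
    using tw unfolding klein_twist_def fun_eq_iff by auto
  have he: "h a = a" "h b = b" "h c = c" "h d = d" "e a = a" "e b = b" "e c = c" "e d = d"
    using fx fixed by auto
  have off: "f x \<notin> {a, b, c, d}" if "x \<notin> {a, b, c, d}" "f \<in> {g, h, e}" for f x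
  proof -
    have "inj f" using that(2) p g permutes_inj by auto
    moreover have "f a = a \<and> f b = b \<and> f c = c \<and> f d = d" using that(2) he fixed by auto
    ultimately show ?thesis using that(1) by (metis empty_iff injD insert_iff)
  qed
  have tr: "transpose u v permutes S" if "u \<in> {a, b, c, d}" "v \<in> {a, b, c, d}" for u v
    using that abcd by (auto intro!: permutes_swap_id)
  let ?t = "transpose a b \<circ> transpose c d" and ?s = "transpose a c \<circ> transpose b d"
    and ?k = "transpose b c \<circ> transpose c d"
  have out: "?t x = x" "?s x = x" "?k x = x" if "x \<notin> {a, b, c, d}" for x
    using that by auto
  have k: "?t a = b" "?t b = a" "?t c = d" "?t d = c" "?s a = c" "?s b = d" "?s c = a" "?s d = b"
    "?k a = a" "?k b = c" "?k c = d" "?k d = b"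
    using abcd by (auto simp: transpose_def)
  have perm: "?t permutes S" "?s permutes S" "?k permutes S"
    by (intro permutes_compose tr; simp)+
  have "evenperm ?k" using abcd by (simp add: evenperm_comp permutation_swap_id evenperm_swap)
  then have "evenperm (e \<circ> ?k)"
    using ev p(1) perm(3) fin by (metis evenperm_comp permutation_permutes)
  moreover have "e \<circ> ?k permutes S" "h \<circ> ?s permutes S"
    by (intro permutes_compose p perm)+
  moreover have "(h (?s (h (?s x))) = x) \<and> e (?k (g (?t x))) = h (?s (e (?k x)))
     \<and> e (?k (h (?s x))) = g (?t (h (?s (e (?k x)))))
     \<and> (g (?t x) = x \<longrightarrow> h (?s x) = x \<and> e (?k x) = x)" for x
  proof (cases "x \<in> {a, b, c, d}")
    case True
    then consider "x = a" | "x = b" | "x = c" | "x = d" by auto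
    then show ?thesis
      by cases (use abcd(1) in \<open>simp_all only: k he fixed, auto\<close>)
  next
    case False
    then have 1: "g x \<notin> {a, b, c, d}" "h x \<notin> {a, b, c, d}" "e x \<notin> {a, b, c, d}" using off by auto
    then have 2: "h (e x) \<notin> {a, b, c, d}" using off[of "e x" h] by auto
    show ?thesis
      using fx[of x] by (simp only: out[OF False] out[OF 1(1)] out[OF 1(2)] out[OF 1(3)] out[OF 2] hh eg eh) simp
  qed
  ultimately show ?thesis
    unfolding klein_twist_def fun_eq_iff by (simp only: o_apply id_apply) blast
qed

text \<open>
  A single transposition is odd, so a nontrivial even involution has at least two 2-cycles; removing two of
  them leaves an even involution with smaller support.
\<close>

lemma even_involution_split:
  assumes fin: "finite S" and g: "g permutes S" "evenperm g" "g \<circ> g = id" "g \<noteq> id"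
  obtains a b c d g' where "distinct [a, b, c, d]" "{a, b, c, d} \<subseteq> S"
    "g = g' \<circ> (transpose a b \<circ> transpose c d)" "g' permutes S" "evenperm g'" "g' \<circ> g' = id"
    "g' a = a" "g' b = b" "g' c = c" "g' d = d"
    "{x. g' x \<noteq> x} \<subset> {x. g x \<noteq> x}"
proof -
  have gg: "g (g x) = x" for x using g(3) by (metis comp_apply id_apply)
  have inj: "g u = g v \<longleftrightarrow> u = v" for u v by (metis gg)
  have ran: "g x \<in> S \<longleftrightarrow> x \<in> S" for x by (rule permutes_in_image[OF g(1)])
  obtain a where a: "g a \<noteq> a" using g(4) by (auto simp: fun_eq_iff)
  have "\<exists>c. c \<noteq> a \<and> c \<noteq> g a \<and> g c \<noteq> c"
  proof (rule ccontr)
    assume "\<not> ?thesis"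
    then have "g = transpose a (g a)" by (auto simp: fun_eq_iff transpose_def gg)
    then show False using g(2) a evenperm_swap by metis
  qed
  then obtain c where c: "c \<noteq> a" "c \<noteq> g a" "g c \<noteq> c" by blast
  let ?b = "g a" and ?d = "g c"
  let ?t = "transpose a ?b \<circ> transpose c ?d"
  have dist: "distinct [a, ?b, c, ?d]" using a c gg inj by auto
  have sub: "{a, ?b, c, ?d} \<subseteq> S" using a c ran g(1) permutes_not_in by fastforce
  have tt: "?t (?t x) = x" for x using dist by (auto simp: transpose_def)
  have tp: "?t permutes S" using sub by (intro permutes_compose permutes_swap_id) auto
  have te: "evenperm ?t" using dist by (simp add: evenperm_comp permutation_swap_id evenperm_swap)
  have tv: "?t a = ?b" "?t ?b = a" "?t c = ?d" "?t ?d = c" using dist by (auto simp: transpose_def)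
  have out: "?t x = x" if "x \<notin> {a, ?b, c, ?d}" for x using that by auto
  have off: "g x \<notin> {a, ?b, c, ?d}" if "x \<notin> {a, ?b, c, ?d}" for x using that gg inj by (metis empty_iff insert_iff)
  define g' where "g' = g \<circ> ?t"
  have g': "g' x = (if x \<in> {a, ?b, c, ?d} then x else g x)" for x
  proof (cases "x \<in> {a, ?b, c, ?d}")
    case True
    then consider "x = a" | "x = ?b" | "x = c" | "x = ?d" by auto
    then show ?thesis using tv gg by cases (auto simp: g'_def)
  next
    case False
    then show ?thesis unfolding g'_def o_apply[of g] out[OF False] by simp
  qed
  show thesis
  proof (rule that[OF dist sub])
    show "g = g' \<circ> ?t" using tt by (simp only: g'_def fun_eq_iff o_apply) simp
    show "g' permutes S" unfolding g'_def by (intro permutes_compose g tp)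
    show "evenperm g'" unfolding g'_def
      using te tp g fin by (metis evenperm_comp permutation_permutes)
    show "g' \<circ> g' = id" using off gg by (auto simp: fun_eq_iff g')
    show "{x. g' x \<noteq> x} \<subset> {x. g x \<noteq> x}" using a by (auto simp: g')
  qed (simp_all add: g')
qed

lemma klein_twist_exists:
  assumes fin: "finite S" and "g permutes S" "evenperm g" "g \<circ> g = id"
  shows "\<exists>h c. klein_twist S g h c"
  using assms(2-)
proof (induction "card {x. g x \<noteq> x}" arbitrary: g rule: less_induct)
  case less
  show ?case
  proof (cases "g = id")
    case True
    then show ?thesis by (intro exI[of _ id]) (simp add: klein_twist_def permutes_id)
  next
    case False
    obtain a b c d g' where *: "distinct [a, b, c, d]" "{a, b, c, d} \<subseteq> S"
    "g = g' \<circ> (transpose a b \<circ> transpose c d)" "g' permutes S" "evenperm g'" "g' \<circ> g' = id"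
    "g' a = a" "g' b = b" "g' c = c" "g' d = d"
    "{x. g' x \<noteq> x} \<subset> {x. g x \<noteq> x}"
      using even_involution_split[OF fin less.prems False] .
    have "finite {x. g x \<noteq> x}"
      using less.prems(1) fin by (auto intro: finite_subset simp: permutes_def)
    then obtain h e where "klein_twist S g' h e"
      using less.hyps[of g'] * psubset_card_mono by blast
    from klein_twist_extend[OF fin this *(4,1,2,7-10)] show ?thesis
      using *(3) by blast
  qed
qed

section \<open>Binary actions of alternating groups\<close>

lemma finite_alt_group: "finite (carrier (alt_group n))"
proof -
  have "finite {p. p permutes {1..n}}" by (rule finite_permutations) simp
  then show ?thesis by (rule finite_subset[rotated]) (auto simp: alt_group_carrier)
qed

locale alternating_gluing_action = gluing_action "alt_group n" E \<phi>
  for n :: nat and E :: "'a set" and \<phi> +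
  assumes six: "n \<ge> 6"
begin

lemma involution_of_nontrivial_stabilizer:
  assumes a: "a \<in> E" and g: "g \<in> carrier (alt_group n)" "\<phi> g a = a" "g \<noteq> id"
  obtains t where "involution t" "\<phi> t a = a"
proof (cases "\<exists>m::nat. involution (g [^]\<^bsub>alt_group n\<^esub> m)")
  case True
  then show thesis using that pow_fixes[OF g(1) a g(2)] by blast
next
  case False
  then obtain m :: nat where m: "g [^]\<^bsub>alt_group n\<^esub> (2 * m + 1) = \<one>\<^bsub>alt_group n\<^esub>"
    using odd_order_or_involution[OF finite_group g(1)] by blast
  have pow: "g [^]\<^bsub>alt_group n\<^esub> (k::nat) = g ^^ k" for k
    by (induction k) (simp_all add: alt_group_one alt_group_mult funpow_Suc_right del: funpow.simps(2))
  have no2: "g z = z" if z: "g (g z) = z" for z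
  proof -
    have "(g ^^ (2 * k)) z = z" for k
      by (induction k) (simp_all add: z)
    then have "(g ^^ (2 * m + 1)) z = g z" by simp
    moreover have "g ^^ (2 * m + 1) = id" using m unfolding pow alt_group_one .
    ultimately show ?thesis by (metis id_apply)
  qed
  obtain k s where "k \<in> carrier (alt_group n)" "involution s" "s \<circ> k \<circ> g = g \<circ> k"
    using involutive_commutator_exists[OF six g(1,3) no2] .
  then show thesis
    using involution_from_commutator[OF a g(1,2), of k s] that by (metis alt_group_mult)
qed

text \<open>
  The twist makes \<open>g\<close>, \<open>h\<close> and \<open>g \<circ> h\<close> conjugate in the alternating group, so all three have maximal fixity.
\<close>

lemma max_fixity_klein_twist:
  assumes g: "max_fixity g" and tw: "klein_twist {1..n} g h c"
  shows "max_fixity h" "Fix h = Fix g"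
proof -
  have gc: "g \<in> carrier (alt_group n)" using g by (simp add: max_fixity_def involution_def)
  have c: "c \<in> carrier (alt_group n)" and hp: "h permutes {1..n}"
    and cg: "c \<circ> g = h \<circ> c" and ch: "c \<circ> h = (g \<circ> h) \<circ> c"
    using tw by (auto simp: klein_twist_def alt_group_carrier)
  have "permutation h" using hp by (auto simp: permutation_permutes)
  then have "evenperm h"
    using gc c cg by (metis alt_group_carrier alt_group_carrier' evenperm_comp)
  then have h: "h \<in> carrier (alt_group n)" using hp by (simp add: alt_group_carrier)
  then have gh: "g \<circ> h \<in> carrier (alt_group n)" using gc by (metis alt_group_mult m_closed)
  show mh: "max_fixity h" using max_fixity_conj[OF g c h] cg by (simp add: alt_group_mult)
  have "max_fixity (g \<circ> h)" using max_fixity_conj[OF mh c gh] ch by (simp add: alt_group_mult)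
  then show "Fix h = Fix g" using Fix_eq_if_commuting[OF g mh] by (simp add: alt_group_mult)
qed

text \<open>
  Write \<open>g = f \<circ> (a b)(c d)\<close> with \<open>f\<close> fixing the four points. A twist of \<open>f\<close> extends over the block in two ways,
  which differ by exchanging \<open>c\<close> and \<open>d\<close>,
  giving partners \<open>p\<close> and \<open>q\<close> of \<open>g\<close> that agree off the block and act there as \<open>(a c)(b d)\<close> and \<open>(a d)(b c)\<close>.
  Both have the fixed points of \<open>g\<close>, hence so does \<open>p \<circ> q = (a b)(c d)\<close>.
\<close>

lemma max_fixity_double_transposition:
  assumes g: "max_fixity g"
  obtains a b c d where "distinct [a, b, c, d]" "{a, b, c, d} \<subseteq> {1..n}"
    "max_fixity (transpose a b \<circ> transpose c d)" "Fix (transpose a b \<circ> transpose c d) = Fix g"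
proof -
  have "involution g" using g by (simp add: max_fixity_def)
  then have gp: "g permutes {1..n}" "evenperm g" "g \<circ> g = id" "g \<noteq> id"
    by (auto simp: involution_def alt_group_mult alt_group_one alt_group_carrier)
  obtain a b c d f where abcd: "distinct [a, b, c, d]" "{a, b, c, d} \<subseteq> {1..n}"
    and gf: "g = f \<circ> (transpose a b \<circ> transpose c d)"
    and f: "f permutes {1..n}" "evenperm f" "f \<circ> f = id"
    and fx: "f a = a" "f b = b" "f c = c" "f d = d"
    by (rule even_involution_split[OF finite_atLeastAtMost gp])
  obtain h e where tw: "klein_twist {1..n} f h e"
    using klein_twist_exists[OF _ f] by auto
  define p q where "p = h \<circ> (transpose a c \<circ> transpose b d)" and "q = h \<circ> (transpose a d \<circ> transpose b c)"
  have "\<exists>e. klein_twist {1..n} g p e"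
    using klein_twist_extend[OF finite_atLeastAtMost tw f(1) abcd fx] unfolding gf p_def by blast
  then have p: "max_fixity p" "Fix p = Fix g" using max_fixity_klein_twist[OF g] by blast+
  have "\<exists>e. klein_twist {1..n} g q e"
  proof -
    have "distinct [a, b, d, c]" "{a, b, d, c} \<subseteq> {1..n}" using abcd by auto
    from klein_twist_extend[OF finite_atLeastAtMost tw f(1) this fx(1,2,4,3)] show ?thesis
      unfolding gf q_def transpose_commute[of d c] by blast
  qed
  then have q: "max_fixity q" "Fix q = Fix g" using max_fixity_klein_twist[OF g] by blast+
  have "p \<circ> q = transpose a b \<circ> transpose c d"
  proof
    fix x
    have h: "h permutes {1..n}" "h a = a" "h b = b" "h c = c" "h d = d" and hh: "h (h y) = y" for y
      using tw fx by (auto simp: klein_twist_def fun_eq_iff)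
    show "(p \<circ> q) x = (transpose a b \<circ> transpose c d) x"
    proof (cases "x \<in> {a, b, c, d}")
      case True
      then show ?thesis using abcd(1) h by (auto simp: p_def q_def)
    next
      case False
      then have "h x \<notin> {a, b, c, d}" using h hh by (metis empty_iff insert_iff)
      then show ?thesis using False hh by (auto simp: p_def q_def)
    qed
  qed
  then have t: "transpose a b \<circ> transpose c d = p \<otimes>\<^bsub>alt_group n\<^esub> q" by (simp add: alt_group_mult)
  have "p \<in> carrier (alt_group n)" "q \<in> carrier (alt_group n)"
    using p q by (auto simp: max_fixity_def involution_def)
  then have "Fix p \<inter> Fix q \<subseteq> Fix (transpose a b \<circ> transpose c d)"
    unfolding t by (auto simp: Fix_iff act_mult)
  then have "Fix g \<subseteq> Fix (transpose a b \<circ> transpose c d)" using p(2) q(2) by simp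
  then show thesis
    using max_fixity_supset[OF g double_transposition_involution[OF abcd(2,1)]] that[OF abcd] by blast
qed

text \<open>
  The set \<open>P\<close> is kept as a parameter because, once one double transposition has
  maximal fixity, all of them will turn out to share its set of fixed points.
\<close>

definition dominant :: "'a set \<Rightarrow> nat \<Rightarrow> nat \<Rightarrow> nat \<Rightarrow> nat \<Rightarrow> bool" where
  "dominant P a b c d \<longleftrightarrow> distinct [a, b, c, d] \<and> {a, b, c, d} \<subseteq> {1..n} \<and>
     max_fixity (transpose a b \<circ> transpose c d) \<and> Fix (transpose a b \<circ> transpose c d) = P"

lemma dominant_sym:
  assumes "dominant P a b c d"
  shows "dominant P b a c d" "dominant P a b d c" "dominant P c d a b"
proof -
  have "transpose c d \<circ> transpose a b = transpose a b \<circ> transpose c d"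
  proof
    fix z show "(transpose c d \<circ> transpose a b) z = (transpose a b \<circ> transpose c d) z"
      using assms by (cases "z \<in> {a, b, c, d}") (auto simp: dominant_def)
  qed
  then show "dominant P b a c d" "dominant P a b d c" "dominant P c d a b"
    using assms by (auto simp: dominant_def transpose_commute)
qed

text \<open>
  The permutations \<open>k\<close> and \<open>l\<close> witness that the new double transposition and its product with
  the old one are conjugate to the old one.
\<close>

lemma dominant_step:
  assumes D: "dominant P a b c d"
    and wxyz: "distinct [w, x, y, z]" "{w, x, y, z} \<subseteq> {1..n}"
    and k: "k \<in> carrier (alt_group n)" "k \<circ> (transpose a b \<circ> transpose c d) = (transpose w x \<circ> transpose y z) \<circ> k"
    and l: "l \<in> carrier (alt_group n)"
      "l \<circ> (transpose a b \<circ> transpose c d) = ((transpose a b \<circ> transpose c d) \<circ> (transpose w x \<circ> transpose y z)) \<circ> l"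
  shows "dominant P w x y z"
proof -
  let ?g = "transpose a b \<circ> transpose c d" and ?h = "transpose w x \<circ> transpose y z"
  have g: "max_fixity ?g" using D by (simp add: dominant_def)
  have gc: "?g \<in> carrier (alt_group n)" using g by (simp add: max_fixity_def involution_def)
  have hc: "?h \<in> carrier (alt_group n)"
    using double_transposition_involution[OF wxyz(2,1)] by (simp add: involution_def)
  have h: "max_fixity ?h" using max_fixity_conj[OF g k(1) hc] k(2) by (simp add: alt_group_mult)
  have "?g \<circ> ?h \<in> carrier (alt_group n)" using gc hc by (metis alt_group_mult m_closed)
  then have "max_fixity (?g \<circ> ?h)" using max_fixity_conj[OF g l(1)] l(2) by (simp add: alt_group_mult)
  then have "Fix ?h = Fix ?g" using Fix_eq_if_commuting[OF g h] by (simp add: alt_group_mult)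
  then show ?thesis using h D wxyz by (simp add: dominant_def)
qed

lemma dominant_replace_pair:
  assumes D: "dominant P a b c d" and ef: "distinct [a, b, c, d, e, f]" "{e, f} \<subseteq> {1..n}"
  shows "dominant P a b e f"
proof (rule dominant_step[OF D])
  have s: "{a, b, c, d, e, f} \<subseteq> {1..n}" using D ef by (auto simp: dominant_def)
  show "distinct [a, b, e, f]" "{a, b, e, f} \<subseteq> {1..n}" using s ef by auto
  show "transpose c e \<circ> transpose d f \<in> carrier (alt_group n)"
    using s ef by (intro double_transposition_in_alt) auto
  show "transpose a e \<circ> transpose b f \<in> carrier (alt_group n)"
    using s ef by (intro double_transposition_in_alt) auto
  show "transpose c e \<circ> transpose d f \<circ> (transpose a b \<circ> transpose c d)
    = transpose a b \<circ> transpose e f \<circ> (transpose c e \<circ> transpose d f)" (is "?lhs = ?rhs")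
  proof (rule ext)
    fix z show "?lhs z = ?rhs z"
      by (cases "z \<in> {a, b, c, d, e, f}") (use ef(1) in auto)
  qed
  show "transpose a e \<circ> transpose b f \<circ> (transpose a b \<circ> transpose c d)
    = transpose a b \<circ> transpose c d \<circ> (transpose a b \<circ> transpose e f) \<circ> (transpose a e \<circ> transpose b f)" (is "?lhs = ?rhs")
  proof (rule ext)
    fix z show "?lhs z = ?rhs z"
      by (cases "z \<in> {a, b, c, d, e, f}") (use ef(1) in auto)
  qed
qed

lemma dominant_regroup:
  assumes D: "dominant P a b c d"
  shows "dominant P a c b d"
proof (rule dominant_step[OF D])
  have s: "{a, b, c, d} \<subseteq> {1..n}" and dist: "distinct [a, b, c, d]" using D by (auto simp: dominant_def)
  show "distinct [a, c, b, d]" "{a, c, b, d} \<subseteq> {1..n}" using s dist by auto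
  show "transpose b c \<circ> transpose c d \<in> carrier (alt_group n)"
    using s dist by (intro double_transposition_in_alt) auto
  show "transpose b d \<circ> transpose d c \<in> carrier (alt_group n)"
    using s dist by (intro double_transposition_in_alt) auto
  show "transpose b c \<circ> transpose c d \<circ> (transpose a b \<circ> transpose c d)
    = transpose a c \<circ> transpose b d \<circ> (transpose b c \<circ> transpose c d)" (is "?lhs = ?rhs")
  proof (rule ext)
    fix z show "?lhs z = ?rhs z"
      by (cases "z \<in> {a, b, c, d}") (use dist in auto)
  qed
  show "transpose b d \<circ> transpose d c \<circ> (transpose a b \<circ> transpose c d)
    = transpose a b \<circ> transpose c d \<circ> (transpose a c \<circ> transpose b d) \<circ> (transpose b d \<circ> transpose d c)" (is "?lhs = ?rhs")
  proof (rule ext)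
    fix z show "?lhs z = ?rhs z"
      by (cases "z \<in> {a, b, c, d}") (use dist in auto)
  qed
qed

text \<open>
  With an auxiliary point \<open>f\<close>, the moves \<open>(c d)(a b)\<close>, \<open>(c d)(e f)\<close>, \<open>(c e)(d f)\<close>, \<open>(c e)(a b)\<close> exchange \<open>d\<close> for \<open>e\<close>.
  This needs the six points \<open>a, b, c, d, e, f\<close>.
\<close>

lemma dominant_replace:
  assumes D: "dominant P a b c d" and e: "e \<in> {1..n}" "e \<notin> {a, b, c}"
  shows "dominant P a b c e"
proof (cases "e = d")
  case False
  have dist: "distinct [a, b, c, d]" and s: "{a, b, c, d} \<subseteq> {1..n}" using D by (auto simp: dominant_def)
  have "card {a, b, c, d, e} \<le> 5" by (intro card_insert_le_m1) auto
  then have "\<not> {1..n} \<subseteq> {a, b, c, d, e}" using six card_mono[of "{a, b, c, d, e}" "{1..n}"] by auto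
  then obtain f where f: "f \<in> {1..n}" "f \<notin> {a, b, c, d, e}" by blast
  have all: "distinct [a, b, c, d, e, f]" "{a, b, c, d, e, f} \<subseteq> {1..n}"
    using dist s e f False by auto
  have "dominant P c d a b" using D by (rule dominant_sym)
  then have "dominant P c d e f" by (rule dominant_replace_pair) (use all in auto)
  then have "dominant P c e d f" by (rule dominant_regroup)
  then have "dominant P c e a b" by (rule dominant_replace_pair) (use all in auto)
  then show ?thesis by (rule dominant_sym)
qed (use D in simp)

text \<open>
  The entries are replaced by the desired ones from left to right. If the next one already occurs further to the
  right, symmetry or regrouping brings it into position; otherwise it replaces an entry that is not yet settled.
\<close>

lemma dominant_everywhere:
  assumes D: "dominant P a b c d" and wxyz: "distinct [w, x, y, z]" "{w, x, y, z} \<subseteq> {1..n}"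
  shows "dominant P w x y z"
proof -
  obtain b c d where D: "dominant P w b c d"
  proof (cases "w \<in> {b, c, d}")
    case True
    then consider "w = b" | "w = c" | "w = d" by blast
    then show thesis
    proof cases
      case 1
      show thesis by (rule that) (use dominant_sym(1)[OF D] 1 in simp)
    next
      case 2
      show thesis by (rule that) (use dominant_sym(3)[OF D] 2 in simp)
    next
      case 3
      show thesis by (rule that) (use dominant_sym(1)[OF dominant_sym(3)[OF D]] 3 in simp)
    qed
  next
    case False
    have "dominant P c d b w"
      using dominant_replace[OF dominant_sym(2)[OF dominant_sym(3)[OF D]], of w] False wxyz(2) by simp
    from that[OF dominant_sym(1)[OF dominant_sym(3)[OF this]]] show thesis .
  qed
  have "\<exists>c d. dominant P w x c d"
  proof (cases "x \<in> {b, c, d}")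
    case True
    then consider "x = b" | "x = c" | "x = d" by blast
    then show ?thesis
      by cases (use D dominant_regroup[OF D] dominant_regroup[OF dominant_sym(2)[OF D]] in blast)+
  next
    case False
    have "dominant P c d w x"
      using dominant_replace[OF dominant_sym(3)[OF D], of x] False wxyz by simp
    then show ?thesis using dominant_sym(3) by blast
  qed
  then obtain c d where D: "dominant P w x c d" by blast
  have "\<exists>d. dominant P w x y d"
  proof (cases "y = c")
    case False
    have "dominant P w x c y" using dominant_replace[OF D, of y] wxyz False by simp
    then show ?thesis using dominant_sym(2) by blast
  qed (use D in blast)
  then obtain d where "dominant P w x y d" by blast
  then show ?thesis using dominant_replace[of P w x y d z] wxyz by simp
qed

text \<open>
  The involution \<open>g\<close> may be replaced by a double transposition, and then all double transpositions fix the
  point \<open>a\<close>. The 3-cycle \<open>(p q)(q r)\<close> is the product of \<open>(u v)(p q)\<close> and \<open>(u v)(q r)\<close>, so all 3-cycles fix \<open>a\<close>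
  as well, and they generate the group.
\<close>

lemma Fix_max_fixity_global:
  assumes g: "max_fixity g" and a: "a \<in> Fix g" and h: "h \<in> carrier (alt_group n)"
  shows "\<phi> h a = a"
proof -
  have aE: "a \<in> E" using a by (simp add: Fix_iff)
  have "\<exists>w x y z. dominant (Fix g) w x y z"
    by (rule max_fixity_double_transposition[OF g]) (auto simp: dominant_def)
  then obtain w x y z where "dominant (Fix g) w x y z" by blast
  then have dom: "dominant (Fix g) p q r s" if "distinct [p, q, r, s]" "{p, q, r, s} \<subseteq> {1..n}" for p q r s
    using dominant_everywhere[OF _ that] by blast
  have three: "three_cycles n \<subseteq> stabilizer (alt_group n) \<phi> a"
  proof
    fix t assume "t \<in> three_cycles n"
    then obtain cs where cs: "t = cycle_of_list cs" "distinct cs" "length cs = 3" "set cs \<subseteq> {1..n}" by auto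
    obtain p q r where pqr: "cs = [p, q, r]" by (rule that[OF stupid_lemma[OF cs(3)]])
    have t: "t = transpose p q \<circ> transpose q r" and dist: "distinct [p, q, r]" and s: "{p, q, r} \<subseteq> {1..n}"
      using cs unfolding pqr by simp_all
    have "card ({1..n} - {p, q, r}) = n - 3" using dist s by (simp add: card_Diff_subset)
    then have "2 \<le> card ({1..n} - {p, q, r})" using six by simp
    then obtain X where "X \<subseteq> {1..n} - {p, q, r}" "card X = 2"
      by (rule obtain_subset_with_card_n) blast
    then obtain u v where uv: "u \<noteq> v" "{u, v} \<subseteq> {1..n} - {p, q, r}"
      unfolding card_2_iff by blast
    have all: "distinct [p, q, r, u, v]" "{p, q, r, u, v} \<subseteq> {1..n}" using dist s uv by auto
    let ?A = "transpose u v \<circ> transpose p q" and ?B = "transpose u v \<circ> transpose q r"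
    have four: "distinct [u, v, p, q]" "distinct [u, v, q, r]"
      "{u, v, p, q} \<subseteq> {1..n}" "{u, v, q, r} \<subseteq> {1..n}"
      using all by auto
    have "max_fixity ?A" "Fix ?A = Fix g" "max_fixity ?B" "Fix ?B = Fix g"
      using dom[OF four(1,3)] dom[OF four(2,4)] by (simp_all only: dominant_def)
    then have AB: "?A \<in> carrier (alt_group n)" "?B \<in> carrier (alt_group n)" "\<phi> ?A a = a" "\<phi> ?B a = a"
      using a unfolding max_fixity_def involution_def by (blast, blast, metis Fix_iff, metis Fix_iff)
    have "t = ?A \<circ> ?B"
    proof
      fix z show "t z = (?A \<circ> ?B) z"
        unfolding t using all(1) by (cases "z \<in> {p, q, r, u, v}") auto
    qed
    then show "t \<in> stabilizer (alt_group n) \<phi> a"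
      using AB aE act_mult[OF AB(1,2) aE] m_closed[OF AB(1,2)]
      by (simp add: stabilizer_def alt_group_mult)
  qed
  have "generate (alt_group n) (three_cycles n) \<subseteq> stabilizer (alt_group n) \<phi> a"
    by (rule generate_subgroup_incl[OF three stabilizer_subgroup[OF aE]])
  then show ?thesis using h alt_group_carrier_as_three_cycles by (auto simp: stabilizer_def)
qed

text \<open>
  The involutions of maximal fixity fix exactly the global fixed points. Every other involution fixes these too
  and, by maximality, nothing else. So a point fixed by an involution is fixed by the whole group.
\<close>

lemma stabilizer_trivial_or_full:
  assumes a: "a \<in> E"
  shows "stabilizer (alt_group n) \<phi> a = {id} \<or> stabilizer (alt_group n) \<phi> a = carrier (alt_group n)"
proof (cases "\<exists>g \<in> carrier (alt_group n). \<phi> g a = a \<and> g \<noteq> id")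
  case True
  then obtain t where t: "involution t" "\<phi> t a = a"
    using involution_of_nontrivial_stabilizer[OF a] by metis
  obtain g where g: "max_fixity g" using ex_max_fixity[OF t(1)] .
  have "Fix g \<subseteq> Fix t"
    using Fix_max_fixity_global[OF g] involution_closed[OF t(1)] by (auto simp: Fix_iff)
  then have "Fix t = Fix g" by (rule max_fixity_supset(2)[OF g t(1)])
  moreover have "a \<in> Fix t" using a t by (simp add: Fix_iff)
  ultimately have "a \<in> Fix g" by simp
  then show ?thesis using Fix_max_fixity_global[OF g] by (auto simp: stabilizer_def)
next
  case False
  then show ?thesis
    using act_one[OF a] one_closed by (auto simp: stabilizer_def alt_group_one)
qed

end

lemma (in group_action) transitive_on_orbit:
  assumes x: "x \<in> E"
  shows "transitive_action G (orbit G \<phi> x) (\<lambda>g. restrict (\<phi> g) (orbit G \<phi> x))"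
proof -
  interpret group G using group_hom group_hom.axioms(1) by blast
  let ?D = "orbit G \<phi> x"
  have sub: "?D \<subseteq> E" using x element_image by (auto simp: orbit_def)
  have closed: "\<phi> g y \<in> ?D" if g: "g \<in> carrier G" and y: "y \<in> ?D" for g y
  proof -
    obtain k where "k \<in> carrier G" "y = \<phi> k x" using y unfolding orbit_def by blast
    then have "\<phi> g y = \<phi> (g \<otimes> k) x" "g \<otimes> k \<in> carrier G" using g x composition_rule by auto
    then show ?thesis by (auto simp: orbit_def)
  qed
  have inv_cancel: "\<phi> g (\<phi> (inv g) y) = y" if "g \<in> carrier G" "y \<in> ?D" for g y
    using that sub composition_rule[of y g "inv g"] id_eq_one by (metis inv_closed r_inv restrict_apply' subsetD)
  have bij: "restrict (\<phi> g) ?D \<in> Bij ?D" if g: "g \<in> carrier G" for g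
  proof -
    have "\<phi> g ` ?D = ?D"
    proof
      show "?D \<subseteq> \<phi> g ` ?D"
      proof
        fix y assume "y \<in> ?D"
        then show "y \<in> \<phi> g ` ?D"
          using inv_cancel[OF g] closed[of "inv g" y] g by (metis imageI inv_closed)
      qed
    qed (use closed g in auto)
    moreover have "inj_on (\<phi> g) ?D" using inj_prop[OF g] sub by (rule inj_on_subset)
    ultimately show ?thesis by (simp add: Bij_def bij_betw_def)
  qed
  show ?thesis
  proof (intro transitive_action.intro group_action.intro group_hom.intro group_hom_axioms.intro
      transitive_action_axioms.intro group_BijGroup)
    show "group G" by (rule group_axioms)
    show "(\<lambda>g. restrict (\<phi> g) ?D) \<in> hom G (BijGroup ?D)"
    proof (rule homI)
      fix g h assume gh: "g \<in> carrier G" "h \<in> carrier G"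
      show "restrict (\<phi> (g \<otimes> h)) ?D = restrict (\<phi> g) ?D \<otimes>\<^bsub>BijGroup ?D\<^esub> restrict (\<phi> h) ?D"
        using gh bij sub closed composition_rule[OF _ gh]
        by (auto simp: BijGroup_def compose_def fun_eq_iff restrict_def)
    qed (use bij in \<open>simp add: BijGroup_def\<close>)
    fix y z assume yz: "y \<in> ?D" "z \<in> ?D"
    then have "z \<in> orbit G \<phi> y"
      using orbit_sym[OF x _ yz(1)] orbit_trans[of y x z] sub x by (meson subsetD)
    then show "\<exists>g\<in>carrier G. restrict (\<phi> g) ?D y = z" using yz by (auto simp: orbit_def)
  qed
qed

theorem theorem1p2:
  fixes n :: nat
    and \<Omega> :: "'a set"
    and \<phi> :: "(nat \<Rightarrow> nat) \<Rightarrow> 'a \<Rightarrow> 'a"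
  assumes "n \<ge> 6"
    and "finite \<Omega>"
    and "binary_action (alt_group n) \<Omega> \<phi>"
  shows "\<forall>\<Delta> \<in> orbits (alt_group n) \<Omega> \<phi>.
    (\<exists>x. \<Delta> = {x}) \<or> regular_orbit (alt_group n) \<phi> \<Delta>"
proof
  fix \<Delta> assume "\<Delta> \<in> orbits (alt_group n) \<Omega> \<phi>"
  then obtain x where x: "x \<in> \<Omega>" and \<Delta>: "\<Delta> = orbit (alt_group n) \<phi> x" by (auto simp: orbits_def)
  interpret gluing_action "alt_group n" \<Omega> \<phi>
    by (rule binary_action_gluing[OF assms(3,2) finite_alt_group])
  interpret alternating_gluing_action n \<Omega> \<phi> by unfold_locales (rule assms(1))
  have sub: "\<Delta> \<subseteq> \<Omega>" unfolding \<Delta> using x act_closed by (auto simp: orbit_def)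
  show "(\<exists>x. \<Delta> = {x}) \<or> regular_orbit (alt_group n) \<phi> \<Delta>"
  proof (cases "\<exists>y \<in> \<Delta>. stabilizer (alt_group n) \<phi> y \<noteq> {id}")
    case True
    then obtain y where y: "y \<in> \<Delta>" "stabilizer (alt_group n) \<phi> y = carrier (alt_group n)"
      using stabilizer_trivial_or_full sub by blast
    have "\<Delta> = {y}"
    proof -
      have "z = y" if "z \<in> \<Delta>" for z
      proof -
        have "z \<in> orbit (alt_group n) \<phi> y"
          using that y(1) x sub orbit_sym orbit_trans unfolding \<Delta> by (meson subsetD)
        then show ?thesis using y(2) by (auto simp: orbit_def stabilizer_def)
      qed
      then show ?thesis using y(1) by blast
    qed
    then show ?thesis by blast
  next
    case False
    then have "\<forall>y\<in>\<Delta>. stabilizer (alt_group n) (\<lambda>g. restrict (\<phi> g) \<Delta>) y = {\<one>\<^bsub>alt_group n\<^esub>}"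
      by (simp add: stabilizer_def alt_group_one)
    then show ?thesis
      using transitive_on_orbit[OF x] unfolding regular_orbit_def regular_action_def \<Delta> by blast
  qed
qed

end
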